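(* Let $I=[0,1]$ and let $f,g\colon I\to I$ be homeomorphisms such that $f\neq g$. Let $(\lambda_i),(\rho_i)$ be the sequences produced from $f,g$ by the algorithm described in the context. Then $f$ and $g$ are cousins if and only if either: (1) $f$ and $g$ commute and there is $N\in\mathbb{N}$ such that $\lambda_i,\rho_i$ are well-defined for all $1\le i\le N$, and $\lambda_N=\rho_N$, or (2) there is an orientation reversing homeomorphism $h\colon I\to I$ such that $h^2=\mathrm{id}$ and $\{f,g\}=\{\mathrm{id},h\}$.
   Context: $\mathbb{N}=\{1,2,\ldots\}$; powers denote iterates. A map is a continuous function. Maps $f,g\colon I\to I$ are cousins if there exist a map $\varphi\colon I\to I$ and $n,m\in\mathbb{N}$ such that $f=\varphi^n$ and $g=\varphi^m$. They commute if $f\circ g=g\circ f$. Relation $\succ$ on homeomorphisms of $I$ (not necessarily increasing): $f\succ g$ if $f^2\neq g^2$ and for every $x\in I$ either $x\le g^2(x)\le f^2(x)$ or $f^2(x)\le g^2(x)\le x$. Algorithm: set $\lambda_1=f$, $\rho_1=g$. For every $i\in\mathbb{N}$ such that $\lambda_i,\rho_i$ are defined and $\lambda_i\succ\rho_i$ or $\rho_i\succ\lambda_i$: if $\lambda_i\succ\rho_i$, set $\lambda_{i+1}=\lambda_i\circ\rho_i^{-1}$ and $\rho_{i+1}=\rho_i$; if $\rho_i\succ\lambda_i$, set $\lambda_{i+1}=\lambda_i$ and $\rho_{i+1}=\rho_i\circ\lambda_i^{-1}$. If neither relation holds, then $\lambda_k,\rho_k$ are not defined for any $k>i$. *)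

theory Defs
  imports "HOL-Analysis.Analysis"
begin

text \<open>
  Self-maps of $I = [0,1]$ are represented by functions \<open>real \<Rightarrow> real\<close>, whose values outside
  \<open>I\<close> are irrelevant: equality of two self-maps is always agreement on \<open>I\<close>.
\<close>

abbreviation I :: "real set"
  where "I \<equiv> {0..1}"

definition eq_on_I :: "(real \<Rightarrow> real) \<Rightarrow> (real \<Rightarrow> real) \<Rightarrow> bool"  (infix "=\<^sub>I" 50)
  where "f =\<^sub>I g \<longleftrightarrow> (\<forall>x\<in>I. f x = g x)"

definition homeo_I :: "(real \<Rightarrow> real) \<Rightarrow> bool"
  where "homeo_I f \<longleftrightarrow> (\<exists>f'. homeomorphism I I f f')"

definition commute_I :: "(real \<Rightarrow> real) \<Rightarrow> (real \<Rightarrow> real) \<Rightarrow> bool"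
  where "commute_I f g \<longleftrightarrow> f \<circ> g =\<^sub>I g \<circ> f"

definition cousins :: "(real \<Rightarrow> real) \<Rightarrow> (real \<Rightarrow> real) \<Rightarrow> bool"
  where "cousins f g \<longleftrightarrow>
    (\<exists>\<phi>. continuous_on I \<phi> \<and> \<phi> ` I \<subseteq> I \<and>
      (\<exists>n m. n \<ge> 1 \<and> m \<ge> 1 \<and> f =\<^sub>I \<phi> ^^ n \<and> g =\<^sub>I \<phi> ^^ m))"

definition succ_I :: "(real \<Rightarrow> real) \<Rightarrow> (real \<Rightarrow> real) \<Rightarrow> bool"  (infix "\<succ>\<^sub>I" 50)
  where "f \<succ>\<^sub>I g \<longleftrightarrow> \<not> (f ^^ 2 =\<^sub>I g ^^ 2) \<and>
    (\<forall>x\<in>I. (x \<le> (g ^^ 2) x \<and> (g ^^ 2) x \<le> (f ^^ 2) x) \<or>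
            ((f ^^ 2) x \<le> (g ^^ 2) x \<and> (g ^^ 2) x \<le> x))"

text \<open>Hence the order of the two tests in \<open>algo_step\<close> below is immaterial.\<close>

lemma succ_I_asym: "f \<succ>\<^sub>I g \<Longrightarrow> \<not> g \<succ>\<^sub>I f"
  unfolding succ_I_def eq_on_I_def by fastforce

definition algo_step ::
    "(real \<Rightarrow> real) \<Rightarrow> (real \<Rightarrow> real) \<Rightarrow> ((real \<Rightarrow> real) \<times> (real \<Rightarrow> real)) option"
  where "algo_step l r =
    (if l \<succ>\<^sub>I r then Some (l \<circ> inv_into I r, r)
     else if r \<succ>\<^sub>I l then Some (l, r \<circ> inv_into I l)
     else None)"

text \<open>
  \<open>algo f g i\<close> is \<open>Some (\<lambda>\<^sub>i, \<rho>\<^sub>i)\<close> if these two terms are defined, and \<open>None\<close> otherwise.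
  Indices start at 1.
\<close>

fun algo ::
    "(real \<Rightarrow> real) \<Rightarrow> (real \<Rightarrow> real) \<Rightarrow> nat \<Rightarrow> ((real \<Rightarrow> real) \<times> (real \<Rightarrow> real)) option"
  where
    "algo f g 0 = None"
  | "algo f g (Suc 0) = Some (f, g)"
  | "algo f g (Suc (Suc i)) =
      (case algo f g (Suc i) of None \<Rightarrow> None | Some (l, r) \<Rightarrow> algo_step l r)"

end

theory Submission
  imports Defs
begin

text \<open>
  If \<open>f\<close> and \<open>g\<close> are the iterates \<open>\<phi>\<^sup>n\<close> and \<open>\<phi>\<^sup>m\<close> of one map \<open>\<phi>\<close>, then \<open>\<phi>\<close> is itself a
  homeomorphism, hence strictly monotone, and \<open>\<phi>\<^sup>2\<close> is increasing.  An orbit of an increasing map is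
  strictly increasing, strictly decreasing or constant, so as soon as \<open>\<phi>\<^sup>2 \<noteq> id\<close>, the relation
  \<open>\<phi>\<^sup>a \<succ> \<phi>\<^sup>b\<close> compares exponents: it holds when \<open>b < a\<close> (\<open>succ_I_funpow\<close>).  The algorithm thus
  replaces the larger of two positive exponents by their difference.  It is Euclid's subtractive
  algorithm, which reaches a pair of equal exponents (\<open>algo_reaches_equal\<close>).  If \<open>\<phi>\<^sup>2 = id\<close>, the only
  iterates of \<open>\<phi>\<close> are \<open>id\<close> and \<open>\<phi>\<close>; as \<open>f \<noteq> g\<close>, both occur and \<open>\<phi> \<noteq> id\<close>.  An increasing involution
  is the identity, so \<open>\<phi>\<close> is decreasing, which is the exceptional case.

  Conversely, each step of the algorithm can be undone by a composition, for instance
  \<open>\<lambda>\<^sub>i = \<lambda>\<^sub>i\<^sub>+\<^sub>1 \<circ> \<rho>\<^sub>i\<^sub>+\<^sub>1\<close>.  If the two sequences meet in a common value, going back from there exhibits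
  \<open>f\<close> and \<open>g\<close> as iterates of that value (\<open>algo_common_root\<close>).
\<close>

section \<open>Iterates of strictly increasing maps\<close>

lemma funpow_mem: "f ` S \<subseteq> S \<Longrightarrow> x \<in> S \<Longrightarrow> (f ^^ n) x \<in> S"
  by (induction n) auto

lemma funpow_less_funpow_if_less:
  fixes f :: "'a::linorder \<Rightarrow> 'a"
  assumes "strict_mono_on S f" "f ` S \<subseteq> S" "x \<in> S" "x < f x" "m < n"
  shows "(f ^^ m) x < (f ^^ n) x"
proof -
  have "(f ^^ k) x < (f ^^ Suc k) x" for k
  proof (induction k)
    case (Suc k)
    then show ?case
      using strict_mono_onD[OF assms(1) funpow_mem funpow_mem, OF assms(2,3,2,3), of k "Suc k"]
      by simp
  qed (use assms in simp)
  then show ?thesis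
    using \<open>m < n\<close> by (rule lift_Suc_mono_less)
qed

lemma funpow_less_funpow_if_greater:
  fixes f :: "'a::linorder \<Rightarrow> 'a"
  assumes "strict_mono_on S f" "f ` S \<subseteq> S" "x \<in> S" "f x < x" "m < n"
  shows "(f ^^ n) x < (f ^^ m) x"
proof -
  have step: "(f ^^ Suc k) x < (f ^^ k) x" for k
  proof (induction k)
    case (Suc k)
    then show ?case
      using strict_mono_onD[OF assms(1) funpow_mem funpow_mem, OF assms(2,3,2,3), of "Suc k" k]
      by simp
  qed (use assms in simp)
  show ?thesis
    using \<open>m < n\<close>
  proof (induction n)
    case (Suc n)
    then show ?case
      using step[of n] by (auto simp: less_Suc_eq)
  qed simp
qed

section \<open>Homeomorphisms of the unit interval\<close>

text \<open>If a composition is bijective, the map applied first is injective and the map applied last is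
  surjective.  In a power both are \<open>f\<close>.\<close>

lemma bij_betw_of_bij_betw_funpow:
  assumes "bij_betw (f ^^ n) S S" "f ` S \<subseteq> S" "n \<ge> 1"
  shows "bij_betw f S S"
proof -
  obtain k where n: "n = Suc k"
    using \<open>n \<ge> 1\<close> by (cases n) auto
  have "(f ^^ k) ` S \<subseteq> S"
    using funpow_mem[OF assms(2)] by blast
  moreover have "(f ^^ n) ` S = f ` ((f ^^ k) ` S)"
    by (simp add: n image_comp)
  moreover have "inj_on f S"
    using assms(1) unfolding n funpow_Suc_right bij_betw_def
    by (blast intro: inj_on_imageI2)
  ultimately show ?thesis
    using assms unfolding bij_betw_def by blast
qed

lemma homeo_I_imp_bij_betw: "homeo_I f \<Longrightarrow> bij_betw f I I"
  unfolding homeo_I_def homeomorphism_def bij_betw_def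
  by (metis inj_on_inverseI)

lemma homeo_I_if_continuous_bij_betw:
  assumes "continuous_on I f" "bij_betw f I I"
  shows "homeo_I f"
  using homeomorphism_compact[of I f I] assms
  unfolding homeo_I_def bij_betw_def by auto

lemma bij_betw_cong_eq_on_I: "f =\<^sub>I g \<Longrightarrow> bij_betw f I I \<longleftrightarrow> bij_betw g I I"
  by (rule bij_betw_cong) (simp add: eq_on_I_def)

text \<open>A continuous injection sends the middle one of three points between the images of the other
  two.  Comparing \<open>f a\<close> with \<open>f b\<close> therefore fixes the position of every value relative to \<open>f a\<close>, and
  then the triple \<open>a < x < y\<close> gives the order of \<open>f x\<close> and \<open>f y\<close>.\<close>

lemma continuous_inj_imp_strict_monotone:
  fixes f :: "'a::linear_continuum_topology \<Rightarrow> 'b::linorder_topology"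
  assumes "continuous_on {a..b} f" "inj_on f {a..b}"
  shows "strict_mono_on {a..b} f \<or> strict_antimono_on {a..b} f"
proof -
  have between: "f u < f v \<and> f v < f w \<or> f w < f v \<and> f v < f u"
    if "u < v" "v < w" "a \<le> u" "w \<le> b" for u v w
    using that
    by (intro continuous_inj_imp_mono continuous_on_subset[OF assms(1)] inj_on_subset[OF assms(2)])
       auto
  show ?thesis
  proof (cases "f a < f b")
    case True
    have "f x < f y" if xy: "x \<in> {a..b}" "y \<in> {a..b}" "x < y" for x y
    proof -
      have from_a: "f a < f z" if "z \<in> {a..b}" "a < z" for z
        using between[of a z b] True that
        by (cases z b rule: linorder_cases) auto
      show ?thesis
        using from_a[of y] from_a[of x] between[of a x y] xy
          by (cases x a rule: linorder_cases) auto
    qed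
    then show ?thesis
      by (auto intro: strict_mono_onI)
  next
    case False
    have "f y < f x" if xy: "x \<in> {a..b}" "y \<in> {a..b}" "x < y" for x y
    proof -
      have "a < b"
        using xy by auto
      then have "f a \<noteq> f b"
        using inj_onD[OF assms(2), of a b] by (auto simp: less_imp_le)
      then have "f b < f a"
        using False by simp
      then have from_a: "f z < f a" if "z \<in> {a..b}" "a < z" for z
        using between[of a z b] that
        by (cases z b rule: linorder_cases) auto
      show ?thesis
        using from_a[of y] from_a[of x] between[of a x y] xy
          by (cases x a rule: linorder_cases) auto
    qed
    then show ?thesis
      by (auto intro: monotone_onI)
  qed
qed

lemma strict_mono_on_square:
  assumes "strict_mono_on S f \<or> strict_antimono_on S f" "f ` S \<subseteq> S"
  shows "strict_mono_on S (f ^^ 2)"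
  using assms by (auto simp: monotone_on_def numeral_2_eq_2 image_subset_iff)

section \<open>The algorithm on iterates of a single map\<close>

lemma eq_on_I_square:
  assumes "l =\<^sub>I \<phi> ^^ a" "bij_betw \<phi> I I"
  shows "l ^^ 2 =\<^sub>I (\<phi> ^^ 2) ^^ a"
proof -
  have "(l ^^ 2) x = ((\<phi> ^^ 2) ^^ a) x" if "x \<in> I" for x
  proof -
    have "(l ^^ 2) x = (\<phi> ^^ a) ((\<phi> ^^ a) x)"
      using that assms funpow_mem[of \<phi> I x a]
      by (simp add: numeral_2_eq_2 eq_on_I_def bij_betw_def)
    also have "\<dots> = (\<phi> ^^ (2 * a)) x"
      by (simp add: mult_2 funpow_add)
    finally show ?thesis
      by (simp add: funpow_mult)
  qed
  then show ?thesis
    by (simp add: eq_on_I_def)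
qed

text \<open>The relation is about squares, so the orbits that matter are those of \<open>\<phi>\<^sup>2\<close>.  They are
  monotone: a point that is not fixed stays on one side of its starting position and moves further
  away with each iteration.  A point that \<open>\<phi>\<^sup>2\<close> moves witnesses that the squares differ.\<close>

lemma succ_I_funpow:
  assumes \<phi>: "bij_betw \<phi> I I" "strict_mono_on I (\<phi> ^^ 2)" "\<not> \<phi> ^^ 2 =\<^sub>I id"
    and l: "l =\<^sub>I \<phi> ^^ a" and r: "r =\<^sub>I \<phi> ^^ b" and "b < a"
  shows "l \<succ>\<^sub>I r"
proof -
  let ?\<psi> = "\<phi> ^^ 2"
  have maps: "?\<psi> ` I \<subseteq> I"
    using funpow_mem[of \<phi> I] \<phi>(1) by (auto simp: bij_betw_def simp del: atLeastAtMost_iff)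
  have l2: "(l ^^ 2) x = (?\<psi> ^^ a) x" and r2: "(r ^^ 2) x = (?\<psi> ^^ b) x" if "x \<in> I" for x
    using that eq_on_I_square[OF l \<phi>(1)] eq_on_I_square[OF r \<phi>(1)]
    by (auto simp: eq_on_I_def)
  have up: "(?\<psi> ^^ i) x < (?\<psi> ^^ j) x" if "x \<in> I" "x < ?\<psi> x" "i < j" for x i j
    using funpow_less_funpow_if_less[OF \<phi>(2) maps] that by blast
  have down: "(?\<psi> ^^ j) x < (?\<psi> ^^ i) x" if "x \<in> I" "?\<psi> x < x" "i < j" for x i j
    using funpow_less_funpow_if_greater[OF \<phi>(2) maps] that by blast
  have fixed: "(?\<psi> ^^ i) x = x" if "?\<psi> x = x" for x i
    using that by (induction i) auto
  obtain x where x: "x \<in> I" "?\<psi> x \<noteq> x"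
    using \<phi>(3) by (auto simp: eq_on_I_def)
  then have "(?\<psi> ^^ a) x \<noteq> (?\<psi> ^^ b) x"
    using up[OF x(1) _ \<open>b < a\<close>] down[OF x(1) _ \<open>b < a\<close>] by (cases "x < ?\<psi> x") auto
  then have "\<not> l ^^ 2 =\<^sub>I r ^^ 2"
    using x(1) l2 r2 by (auto simp: eq_on_I_def)
  moreover have "x \<le> (r ^^ 2) x \<and> (r ^^ 2) x \<le> (l ^^ 2) x \<or>
      (l ^^ 2) x \<le> (r ^^ 2) x \<and> (r ^^ 2) x \<le> x" if x: "x \<in> I" for x
  proof (cases x "?\<psi> x" rule: linorder_cases)
    case less
    then have "(?\<psi> ^^ 0) x \<le> (?\<psi> ^^ b) x"
      using up[OF x, of 0 b] by (cases "b = 0") auto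
    then show ?thesis
      using up[OF x less \<open>b < a\<close>] l2[OF x] r2[OF x] by simp
  next
    case equal
    then show ?thesis
      using l2[OF x] r2[OF x] fixed[of x] by simp
  next
    case greater
    then have "(?\<psi> ^^ b) x \<le> (?\<psi> ^^ 0) x"
      using down[OF x, of 0 b] by (cases "b = 0") auto
    then show ?thesis
      using down[OF x greater \<open>b < a\<close>] l2[OF x] r2[OF x] by simp
  qed
  ultimately show ?thesis
    unfolding succ_I_def by blast
qed

lemma comp_inv_funpow:
  assumes \<phi>: "bij_betw \<phi> I I"
    and l: "l =\<^sub>I \<phi> ^^ a" and r: "r =\<^sub>I \<phi> ^^ b" and "b \<le> a"
  shows "l \<circ> inv_into I r =\<^sub>I \<phi> ^^ (a - b)"
proof -
  have bij: "bij_betw r I I"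
    using bij_betw_cong_eq_on_I[OF r] bij_betw_funpow[OF \<phi>] by blast
  have "l (inv_into I r x) = (\<phi> ^^ (a - b)) x" if "x \<in> I" for x
  proof -
    have y: "inv_into I r x \<in> I" "r (inv_into I r x) = x"
      using that bij inv_into_into[of x r I] f_inv_into_f[of x r I]
      unfolding bij_betw_def by blast+
    have "l (inv_into I r x) = (\<phi> ^^ (a - b)) ((\<phi> ^^ b) (inv_into I r x))"
      using l y(1) \<open>b \<le> a\<close> funpow_add[of "a - b" b \<phi>] by (simp add: eq_on_I_def)
    then show ?thesis
      using r y by (simp add: eq_on_I_def)
  qed
  then show ?thesis
    by (simp add: eq_on_I_def)
qed

lemma algo_Suc: "i \<ge> 1 \<Longrightarrow> algo f g i = Some (l, r) \<Longrightarrow> algo f g (Suc i) = algo_step l r"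
  by (cases i) auto

text \<open>This is the termination of Euclid's algorithm: the sum of the exponents drops at every step,
  and both stay positive because only the larger one is reduced.\<close>

lemma algo_reaches_equal:
  assumes \<phi>: "bij_betw \<phi> I I" "strict_mono_on I (\<phi> ^^ 2)" "\<not> \<phi> ^^ 2 =\<^sub>I id"
    and "algo f g i = Some (l, r)" "i \<ge> 1"
    and "l =\<^sub>I \<phi> ^^ a" "r =\<^sub>I \<phi> ^^ b" "a \<ge> 1" "b \<ge> 1"
  shows "\<exists>N\<ge>1. \<exists>l r. algo f g N = Some (l, r) \<and> l =\<^sub>I r"
  using assms(4-)
proof (induction "a + b" arbitrary: a b i l r rule: less_induct)
  case less
  note next_pair = algo_Suc[OF less.prems(2,1)]
  consider "a = b" | "b < a" | "a < b"
    by linarith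
  then show ?case
  proof cases
    case 1
    then show ?thesis
      using less.prems by (auto simp: eq_on_I_def)
  next
    case 2
    have "l \<succ>\<^sub>I r"
      using succ_I_funpow[OF \<phi> less.prems(3,4) 2] .
    then have "algo f g (Suc i) = Some (l \<circ> inv_into I r, r)"
      using next_pair by (simp add: algo_step_def)
    moreover have "l \<circ> inv_into I r =\<^sub>I \<phi> ^^ (a - b)"
      using comp_inv_funpow[OF \<phi>(1) less.prems(3,4)] 2 by simp
    ultimately show ?thesis
      using less.hyps[of "a - b" b "Suc i"] less.prems 2 by simp
  next
    case 3
    have "r \<succ>\<^sub>I l"
      using succ_I_funpow[OF \<phi> less.prems(4,3) 3] .
    then have "algo f g (Suc i) = Some (l, r \<circ> inv_into I l)"
      using next_pair succ_I_asym by (auto simp: algo_step_def)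
    moreover have "r \<circ> inv_into I l =\<^sub>I \<phi> ^^ (b - a)"
      using comp_inv_funpow[OF \<phi>(1) less.prems(4,3)] 3 by simp
    ultimately show ?thesis
      using less.hyps[of a "b - a" "Suc i"] less.prems 3 by simp
  qed
qed

lemma algo_defined_downward:
  assumes "algo f g N \<noteq> None" "1 \<le> i" "i \<le> N"
  shows "algo f g i \<noteq> None"
  using assms(3,1,2)
proof (induction N rule: dec_induct)
  case (step n)
  then show ?case
    by (cases n) (auto split: option.splits)
qed

section \<open>Undoing the steps of the algorithm\<close>

lemma homeo_I_comp_inv_into:
  assumes "homeo_I l" "homeo_I r"
  shows "homeo_I (l \<circ> inv_into I r)"
proof -
  obtain l' r' where l': "homeomorphism I I l l'" and r': "homeomorphism I I r r'"
    using assms by (auto simp: homeo_I_def)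
  have inv: "inv_into I r x = r' x" if "x \<in> I" for x
  proof (rule inv_into_f_eq)
    show "inj_on r I"
      using homeo_I_imp_bij_betw[OF assms(2)] by (simp add: bij_betw_def)
    show "r' x \<in> I" "r (r' x) = x"
      using that r' homeomorphism_image2[OF r']
      by (auto simp: homeomorphism_apply2 simp del: atLeastAtMost_iff)
  qed
  have "homeomorphism I I (l \<circ> r') (r \<circ> l')"
    using homeomorphism_compose[OF homeomorphism_symD[OF r'] l'] .
  then have "homeomorphism I I (l \<circ> inv_into I r) (r \<circ> l')"
    by (rule homeomorphism_cong) (use inv in auto)
  then show ?thesis
    by (auto simp: homeo_I_def)
qed

text \<open>The common value in which the algorithm ends is to serve as the map \<open>\<phi>\<close>, so it must be
  continuous, and this has to be carried through all steps.\<close>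

lemma algo_homeo_I:
  assumes "homeo_I f" "homeo_I g" "algo f g i = Some (l, r)"
  shows "homeo_I l \<and> homeo_I r"
  using assms(3)
proof (induction i arbitrary: l r)
  case (Suc i)
  show ?case
  proof (cases i)
    case 0
    then show ?thesis
      using Suc.prems assms by auto
  next
    case (Suc j)
    then obtain l' r' where prev: "algo f g i = Some (l', r')" and "algo_step l' r' = Some (l, r)"
      using Suc.prems by (auto split: option.splits)
    then show ?thesis
      using Suc.IH[OF prev] homeo_I_comp_inv_into
      by (auto simp: algo_step_def split: if_splits)
  qed
qed simp

lemma funpow_of_comp_inv:
  assumes \<phi>: "bij_betw \<phi> I I" and r: "bij_betw r I I"
    and "l \<circ> inv_into I r =\<^sub>I \<phi> ^^ a" and "r =\<^sub>I \<phi> ^^ b"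
  shows "l =\<^sub>I \<phi> ^^ (a + b)"
proof -
  have "l x = (\<phi> ^^ (a + b)) x" if "x \<in> I" for x
  proof -
    have "r x \<in> I" "inv_into I r (r x) = x"
      using that r by (auto simp: bij_betw_def)
    then have "l x = (\<phi> ^^ a) (r x)"
      using assms(3) by (metis comp_apply eq_on_I_def)
    then show ?thesis
      using assms(4) that by (simp add: funpow_add eq_on_I_def)
  qed
  then show ?thesis
    by (simp add: eq_on_I_def)
qed

text \<open>Undoing a step adds one of the two exponents to the other, so they remain positive all the way
  back to the initial pair.\<close>

lemma algo_common_root:
  assumes f: "homeo_I f" and g: "homeo_I g" and \<phi>: "bij_betw \<phi> I I"
    and "algo f g i = Some (l, r)" "l =\<^sub>I \<phi> ^^ a" "r =\<^sub>I \<phi> ^^ b" "a \<ge> 1" "b \<ge> 1"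
  shows "\<exists>n m. n \<ge> 1 \<and> m \<ge> 1 \<and> f =\<^sub>I \<phi> ^^ n \<and> g =\<^sub>I \<phi> ^^ m"
  using assms(4-)
proof (induction i arbitrary: l r a b)
  case (Suc i)
  show ?case
  proof (cases i)
    case 0
    then show ?thesis
      using Suc.prems by auto
  next
    case (Suc j)
    then obtain l' r' where prev: "algo f g i = Some (l', r')"
        and step: "algo_step l' r' = Some (l, r)"
      using Suc.prems by (auto split: option.splits)
    have bij: "bij_betw l' I I" "bij_betw r' I I"
      using algo_homeo_I[OF f g prev] by (simp_all add: homeo_I_imp_bij_betw)
    have "(l = l' \<circ> inv_into I r' \<and> r = r') \<or> (l = l' \<and> r = r' \<circ> inv_into I l')"
      using step by (auto simp: algo_step_def split: if_splits)
    then consider "l = l' \<circ> inv_into I r'" "r = r'" | "l = l'" "r = r' \<circ> inv_into I l'"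
      by blast
    then show ?thesis
    proof cases
      case 1
      have r': "r' =\<^sub>I \<phi> ^^ b"
        using Suc.prems(3) 1(2) by simp
      have "l' =\<^sub>I \<phi> ^^ (a + b)"
        using funpow_of_comp_inv[OF \<phi> bij(2) Suc.prems(2)[unfolded 1(1)] r'] .
      then show ?thesis
        by (rule Suc.IH[OF prev _ r']) (use Suc.prems(4,5) in simp_all)
    next
      case 2
      have l': "l' =\<^sub>I \<phi> ^^ a"
        using Suc.prems(2) 2(1) by simp
      have "r' =\<^sub>I \<phi> ^^ (b + a)"
        using funpow_of_comp_inv[OF \<phi> bij(1) Suc.prems(3)[unfolded 2(2)] l'] .
      then show ?thesis
        by (rule Suc.IH[OF prev l']) (use Suc.prems(4,5) in simp_all)
    qed
  qed
qed simp

section \<open>Iterates of an involution\<close>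

lemma funpow_involution:
  assumes "\<phi> ^^ 2 =\<^sub>I id"
  shows "\<phi> ^^ n =\<^sub>I (if even n then id else \<phi>)"
proof -
  have "\<phi> (\<phi> x) = x" if "x \<in> I" for x
    using assms(1) that by (simp add: eq_on_I_def numeral_2_eq_2)
  then show ?thesis
    by (induction n) (auto simp: eq_on_I_def)
qed

lemma strict_mono_on_involution:
  fixes f :: "'a::linorder \<Rightarrow> 'a"
  assumes "strict_mono_on S f" "f ` S \<subseteq> S" "x \<in> S" "f (f x) = x"
  shows "f x = x"
proof (cases x "f x" rule: linorder_cases)
  case less
  then show ?thesis
    using funpow_less_funpow_if_less[OF assms(1-3), of 0 2] assms(4)
    by (simp add: numeral_2_eq_2)
next
  case greater
  then show ?thesis
    using funpow_less_funpow_if_greater[OF assms(1-3), of 0 2] assms(4)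
    by (simp add: numeral_2_eq_2)
qed simp

section \<open>The characterisation of cousins\<close>

theorem theorem4p29:
  fixes f g :: "real \<Rightarrow> real"
  assumes "homeo_I f" and "homeo_I g" and "\<not> f =\<^sub>I g"
  shows "cousins f g \<longleftrightarrow>
    (commute_I f g \<and>
      (\<exists>N\<ge>1. (\<forall>i\<in>{1..N}. algo f g i \<noteq> None) \<and>
             (\<exists>l r. algo f g N = Some (l, r) \<and> l =\<^sub>I r))) \<or>
    (\<exists>h. homeo_I h \<and> strict_antimono_on I h \<and> h ^^ 2 =\<^sub>I id \<and>
         ((f =\<^sub>I id \<and> g =\<^sub>I h) \<or> (f =\<^sub>I h \<and> g =\<^sub>I id)))"
    (is "_ \<longleftrightarrow> ?algorithm \<or> ?involution")
proof
  assume "cousins f g"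
  then obtain \<phi> n m where cont: "continuous_on I \<phi>" and maps: "\<phi> ` I \<subseteq> I"
      and nm: "n \<ge> 1" "m \<ge> 1" and f: "f =\<^sub>I \<phi> ^^ n" and g: "g =\<^sub>I \<phi> ^^ m"
    unfolding cousins_def by blast
  have bij: "bij_betw \<phi> I I"
    using bij_betw_of_bij_betw_funpow[OF _ maps nm(1)] bij_betw_cong_eq_on_I[OF f]
      homeo_I_imp_bij_betw[OF assms(1)] by blast
  have monotone: "strict_mono_on I \<phi> \<or> strict_antimono_on I \<phi>"
    using continuous_inj_imp_strict_monotone[OF cont] bij by (simp add: bij_betw_def)
  show "?algorithm \<or> ?involution"
  proof (cases "\<phi> ^^ 2 =\<^sub>I id")
    case True
    have parity: "f =\<^sub>I (if even n then id else \<phi>)" "g =\<^sub>I (if even m then id else \<phi>)"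
      using funpow_involution[OF True] f g by (simp_all add: eq_on_I_def)
    have "even n \<noteq> even m"
      using parity assms(3) by (cases "even n"; cases "even m") (auto simp: eq_on_I_def)
    then have pair: "f =\<^sub>I id \<and> g =\<^sub>I \<phi> \<or> f =\<^sub>I \<phi> \<and> g =\<^sub>I id"
      using parity by (auto split: if_splits)
    have "\<not> strict_mono_on I \<phi>"
    proof
      assume "strict_mono_on I \<phi>"
      then have "\<phi> =\<^sub>I id"
        using strict_mono_on_involution[OF _ maps] True by (simp add: eq_on_I_def numeral_2_eq_2)
      then show False
        using pair assms(3) by (auto simp: eq_on_I_def)
    qed
    then show ?thesis
      using monotone homeo_I_if_continuous_bij_betw[OF cont bij] True pair by blast
  next
    case False
    have "\<exists>N\<ge>1. \<exists>l r. algo f g N = Some (l, r) \<and> l =\<^sub>I r"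
      using algo_reaches_equal[OF bij strict_mono_on_square[OF monotone maps] False, of f g 1]
        f g nm by simp
    then obtain N l r where N: "N \<ge> 1" "algo f g N = Some (l, r)" "l =\<^sub>I r"
      by blast
    moreover have "\<forall>i\<in>{1..N}. algo f g i \<noteq> None"
      using algo_defined_downward[of f g N] N(2) by auto
    moreover have "commute_I f g"
    proof -
      have "f (g x) = g (f x)" if "x \<in> I" for x
      proof -
        have "f (g x) = (\<phi> ^^ (n + m)) x" "g (f x) = (\<phi> ^^ (m + n)) x"
          using that f g funpow_mem[OF maps that] by (simp_all add: eq_on_I_def funpow_add)
        then show ?thesis
          by (simp add: add.commute)
      qed
      then show ?thesis
        by (simp add: commute_I_def eq_on_I_def)
    qed
    ultimately show ?thesis
      by blast
  qed
next
  assume "?algorithm \<or> ?involution"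
  then show "cousins f g"
  proof
    assume ?algorithm
    then obtain N l r where N: "algo f g N = Some (l, r)" "l =\<^sub>I r"
      by blast
    have "homeo_I l"
      using algo_homeo_I[OF assms(1,2) N(1)] by blast
    then have "continuous_on I l" and bij: "bij_betw l I I"
      using homeo_I_imp_bij_betw by (auto simp: homeo_I_def homeomorphism_def)
    moreover have "\<exists>n m. n \<ge> 1 \<and> m \<ge> 1 \<and> f =\<^sub>I l ^^ n \<and> g =\<^sub>I l ^^ m"
      using algo_common_root[OF assms(1,2) bij N(1), of 1 1] N(2) by (simp add: eq_on_I_def)
    ultimately show ?thesis
      unfolding cousins_def bij_betw_def by blast
  next
    assume ?involution
    then obtain h where h: "homeo_I h" "h ^^ 2 =\<^sub>I id"
        and pair: "f =\<^sub>I id \<and> g =\<^sub>I h \<or> f =\<^sub>I h \<and> g =\<^sub>I id"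
      by blast
    have "continuous_on I h" "h ` I \<subseteq> I"
      using h(1) by (auto simp: homeo_I_def homeomorphism_def)
    (* Exponents are positive, so the identity has to appear as the second iterate of h. *)
    moreover have "f =\<^sub>I h ^^ 2 \<and> g =\<^sub>I h ^^ 1 \<or> f =\<^sub>I h ^^ 1 \<and> g =\<^sub>I h ^^ 2"
      using pair h(2) by (simp add: eq_on_I_def)
    moreover have "(1::nat) \<le> 1" "(1::nat) \<le> 2"
      by simp_all
    ultimately show ?thesis
      unfolding cousins_def by blast
  qed
qed

end
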